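(* Suppose that $X_t=\gamma t+\sigma W_t+\int_0^t\int_{\mathbb R} z\,dN(s,z)$, $t\in[0,T]$, is the Lévy process with characteristic triplet $(\gamma,\sigma,\nu)$ described in the context. Then for all $t\in[0,T]$ and $x\in\mathbb R$ the probability density function $f_{X_t}(x)$ of $X_t$ under $\mathbb Q$ can be represented as $$f_{X_t}(x)=\frac1{2\pi}\int_{\mathbb R}\exp\Big\{-iux+t\Big(iu\gamma-\tfrac12\sigma^2u^2+\int_{\mathbb R}[e^{iuz}-1]\,d\nu(z)\Big)\Big\}\,du .$$
   Context: $(\Omega,\mathbb F,(\mathcal F_t)_{t\in[0,T]},\mathbb Q)$ is a filtered probability space satisfying the usual hypotheses, $0<T<\infty$. $W$ is a standard Brownian motion under $\mathbb Q$ and $N$ is a Poisson random measure on $[0,T]\times\mathbb R$, independent of $W$ under $\mathbb Q$, with compensator $d\nu(z)\,ds$, where the Lévy measure $\nu$ is positive and finite with $\nu(\{0\})=0$ and $\int_{\mathbb R}(1\wedge z^2)\,d\nu(z)<\infty$. The constants are $\sigma>0$ and $\gamma=\eta-\sigma^2/2$ with $\eta\in\mathbb R$.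
   Formalization: The representation is stated for 0 < t ≤ T, for the continuous density of X_t (any other density agrees with it almost everywhere); at t = 0, X_0 = 0 almost surely has no density and the integral diverges, so that time is excluded. *)

theory Defs
  imports "HOL-Probability.Probability"
begin

(* Filtered probability space over the time interval [0,T] satisfying the usual hypotheses: the
   first completeness axiom gives both completeness of (Omega, F, Q) and that the initial
   sigma-algebra contains all Q-null sets; the second is right-continuity. Only the values of F
   on [0,T] matter. *)
locale usual_filtered_prob_space = prob_space Q
  for Q :: "'a measure" +
  fixes F :: "real \<Rightarrow> 'a measure" and T :: real
  assumes horizon_pos: "0 < T"
    and subalgebra_F: "\<And>t. t \<in> {0..T} \<Longrightarrow> subalgebra Q (F t)"
    and sets_F_mono: "\<And>s t. 0 \<le> s \<Longrightarrow> s \<le> t \<Longrightarrow> t \<le> T \<Longrightarrow> sets (F s) \<subseteq> sets (F t)"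
    and complete_F: "\<And>A B. B \<in> null_sets Q \<Longrightarrow> A \<subseteq> B \<Longrightarrow> A \<in> sets (F 0)"
    and right_cont_F: "\<And>t. t \<in> {0..<T} \<Longrightarrow> sets (F t) = (\<Inter>u\<in>{t<..T}. sets (F u))"

definition standard_brownian_motion :: "'a measure \<Rightarrow> real \<Rightarrow> (real \<Rightarrow> 'a \<Rightarrow> real) \<Rightarrow> bool" where
  "standard_brownian_motion Q T W \<longleftrightarrow>
     (\<forall>t\<in>{0..T}. W t \<in> borel_measurable Q) \<and>
     (AE \<omega> in Q. W 0 \<omega> = 0) \<and>
     (\<forall>n. \<forall>\<tau>::nat \<Rightarrow> real.
        (\<forall>i\<le>n. \<tau> i \<in> {0..T}) \<and> (\<forall>i<n. \<tau> i \<le> \<tau> (Suc i)) \<longrightarrow>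
        prob_space.indep_vars Q (\<lambda>_. borel) (\<lambda>i \<omega>. W (\<tau> (Suc i)) \<omega> - W (\<tau> i) \<omega>) {..<n}) \<and>
     (\<forall>s t. 0 \<le> s \<and> s < t \<and> t \<le> T \<longrightarrow>
        distributed Q lborel (\<lambda>\<omega>. W t \<omega> - W s \<omega>) (normal_density 0 (sqrt (t - s)))) \<and>
     (AE \<omega> in Q. continuous_on {0..T} (\<lambda>t. W t \<omega>))"

(* The Poisson weights are written out because poisson_pmf requires a strictly positive rate,
   whereas sets of intensity 0 must be allowed (there 0 ^ 0 = 1 gives the point mass at 0). *)
definition poisson_random_measure :: "'a measure \<Rightarrow> 'b measure \<Rightarrow> ('a \<Rightarrow> 'b measure) \<Rightarrow> bool" where
  "poisson_random_measure Q \<mu> N \<longleftrightarrow>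
     (\<forall>\<omega>\<in>space Q. sets (N \<omega>) = sets \<mu>) \<and>
     (\<forall>A\<in>sets \<mu>. (\<lambda>\<omega>. emeasure (N \<omega>) A) \<in> borel_measurable Q) \<and>
     (\<forall>A\<in>sets \<mu>. emeasure \<mu> A < \<infinity> \<longrightarrow>
        (\<forall>k::nat. measure Q {\<omega> \<in> space Q. emeasure (N \<omega>) A = of_nat k}
           = exp (- measure \<mu> A) * measure \<mu> A ^ k / fact k)) \<and>
     (\<forall>A\<in>sets \<mu>. emeasure \<mu> A = \<infinity> \<longrightarrow> (AE \<omega> in Q. emeasure (N \<omega>) A = \<infinity>)) \<and>
     (\<forall>n. \<forall>A::nat \<Rightarrow> 'b set.
        (\<forall>i<n. A i \<in> sets \<mu>) \<and> disjoint_family_on A {..<n} \<longrightarrow>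
        prob_space.indep_vars Q (\<lambda>_. borel) (\<lambda>i \<omega>. emeasure (N \<omega>) (A i)) {..<n})"

definition process_sigma :: "'a measure \<Rightarrow> real \<Rightarrow> (real \<Rightarrow> 'a \<Rightarrow> real) \<Rightarrow> 'a set set" where
  "process_sigma Q T W = sigma_sets (space Q)
     {W t -` B \<inter> space Q | t B. t \<in> {0..T} \<and> B \<in> sets borel}"

definition random_measure_sigma :: "'a measure \<Rightarrow> 'b measure \<Rightarrow> ('a \<Rightarrow> 'b measure) \<Rightarrow> 'a set set" where
  "random_measure_sigma Q \<mu> N = sigma_sets (space Q)
     {(\<lambda>\<omega>. emeasure (N \<omega>) A) -` B \<inter> space Q | A B. A \<in> sets \<mu> \<and> B \<in> sets borel}"

definition jump_intensity :: "real \<Rightarrow> real measure \<Rightarrow> (real \<times> real) measure" where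
  "jump_intensity T \<nu> = restrict_space lborel {0..T} \<Otimes>\<^sub>M \<nu>"

definition levy_measure :: "real measure \<Rightarrow> bool" where
  "levy_measure \<nu> \<longleftrightarrow> sets \<nu> = sets borel \<and> emeasure \<nu> {0} = 0 \<and>
     (\<integral>\<^sup>+ z. ennreal (min 1 (z\<^sup>2)) \<partial>\<nu>) < \<infinity>"

definition real_pdf :: "'a measure \<Rightarrow> ('a \<Rightarrow> real) \<Rightarrow> (real \<Rightarrow> real) \<Rightarrow> bool" where
  "real_pdf Q Y f \<longleftrightarrow> (\<forall>x. 0 \<le> f x) \<and> distributed Q lborel Y (\<lambda>x. ennreal (f x))"

definition inversion_integrand ::
    "real \<Rightarrow> real \<Rightarrow> real measure \<Rightarrow> real \<Rightarrow> real \<Rightarrow> real \<Rightarrow> complex" where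
  "inversion_integrand \<gamma> \<sigma> \<nu> t x u =
     exp (- \<i> * of_real u * of_real x
          + of_real t * (\<i> * of_real u * of_real \<gamma> - 1 / 2 * (of_real \<sigma>)\<^sup>2 * (of_real u)\<^sup>2
                         + (\<integral>z. (exp (\<i> * of_real u * of_real z) - 1) \<partial>\<nu>)))"

end

theory Submission
  imports Defs
begin

text \<open>Campbell's formula gives the characteristic function of the jump part \<open>S\<close> of \<open>X\<^sub>t\<close>.
  Since \<open>X\<^sub>t\<close> is the sum of \<open>S\<close> and an independent Gaussian, its density is
  the mixture over the law of \<open>S\<close> of shifted Gaussian densities (compare characteristic functions).
  The Gaussian density is, up to scaling, its own Fourier transform, so it is given by the inversion
  integral; Fubini transfers this to the mixture, no general inversion theorem being needed. At time
  \<open>0\<close> the law is a point mass and has no density.\<close>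

subsection \<open>Gaussian mixtures\<close>

text \<open>The substitution \<open>x = m + s * y\<close> reduces this to the standard normal law,
  whose characteristic function is known.\<close>

lemma char_normal_density:
  assumes "0 < s"
  shows "char (density lborel (normal_density m s)) v
    = exp (\<i> * of_real (v * m) - of_real (s\<^sup>2 * v\<^sup>2 / 2))"
proof -
  have std: "s * normal_density m s (m + s * x) = std_normal_density x" for x
    using assms by (simp add: normal_density_def real_sqrt_mult field_simps power2_eq_square)
  have "char (density lborel (normal_density m s)) v
      = (CLINT x|lborel. normal_density m s x *\<^sub>R iexp (v * x))"
    by (simp add: char_def integral_density)
  also have "\<dots> = s *\<^sub>R (CLINT x|lborel. normal_density m s (m + s * x) *\<^sub>R iexp (v * (m + s * x)))"
    using assms by (subst lborel_integral_real_affine[where c=s and t=m]) auto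
  also have "\<dots> = (CLINT x|lborel. s *\<^sub>R (normal_density m s (m + s * x) *\<^sub>R iexp (v * (m + s * x))))"
    by (rule integral_scaleR_right[symmetric])
  also have "\<dots> = (CLINT x|lborel. iexp (v * m) * (std_normal_density x *\<^sub>R iexp ((v * s) * x)))"
    by (intro Bochner_Integration.integral_cong refl)
      (simp only: scaleR_scaleR std, simp add: exp_add[symmetric] algebra_simps)
  also have "\<dots> = iexp (v * m) * (CLINT x|lborel. std_normal_density x *\<^sub>R iexp ((v * s) * x))"
    by (rule integral_mult_right_zero)
  also have "(CLINT x|lborel. std_normal_density x *\<^sub>R iexp ((v * s) * x))
      = char std_normal_distribution (v * s)"
    by (simp add: char_def integral_density)
  also have "\<dots> = exp (- of_real (s\<^sup>2 * v\<^sup>2 / 2))"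
    by (simp add: char_std_normal_distribution power_mult_distrib mult.commute flip: exp_of_real)
  finally show ?thesis
    by (simp add: exp_add[symmetric])
qed

text \<open>Reads the Gaussian factor of the inversion integrand as a multiple of a normal density
  of width \<open>1 / s\<close>, so that integrability and Fourier transform follow from facts about
  normal laws.\<close>

lemma gaussian_exponential_eq_normal_density:
  assumes "0 < s"
  shows "exp (- (s\<^sup>2 * u\<^sup>2 / 2)) = sqrt (2 * pi) / s * normal_density 0 (1 / s) u"
  using assms by (simp add: normal_density_def real_sqrt_mult real_sqrt_divide field_simps)

lemma integrable_gaussian_exponential:
  assumes "0 < s"
  shows "integrable lborel (\<lambda>u::real. exp (- (s\<^sup>2 * u\<^sup>2 / 2)))"
  using integrable_normal_density[of "1 / s" 0] assms
  by (simp add: gaussian_exponential_eq_normal_density[OF assms])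

text \<open>Up to a constant the integral is the characteristic function, at \<open>m - x\<close>,
  of the centred normal law of width \<open>1 / s\<close>; that function is again Gaussian, now of
  width \<open>s\<close>.\<close>

lemma normal_density_Fourier_inversion:
  assumes "0 < s"
  shows "complex_of_real (normal_density m s x)
    = 1 / (2 * of_real pi) * (CLINT u|lborel. iexp (u * (m - x)) * of_real (exp (- (s\<^sup>2 * u\<^sup>2 / 2))))"
proof -
  have "(CLINT u|lborel. iexp (u * (m - x)) * of_real (exp (- (s\<^sup>2 * u\<^sup>2 / 2))))
      = (CLINT u|lborel. of_real (sqrt (2 * pi) / s)
           * (normal_density 0 (1 / s) u *\<^sub>R iexp ((m - x) * u)))"
    by (simp only: gaussian_exponential_eq_normal_density[OF assms]) (simp add: scaleR_conv_of_real mult_ac)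
  also have "\<dots> = of_real (sqrt (2 * pi) / s)
      * (CLINT u|lborel. normal_density 0 (1 / s) u *\<^sub>R iexp ((m - x) * u))"
    by (rule integral_mult_right_zero)
  also have "\<dots> = of_real (sqrt (2 * pi) / s) * char (density lborel (normal_density 0 (1 / s))) (m - x)"
    by (simp add: char_def integral_density)
  also have "\<dots> = of_real (sqrt (2 * pi) / s * exp (- ((1 / s)\<^sup>2 * (m - x)\<^sup>2 / 2)))"
    using assms by (subst char_normal_density) (auto simp: exp_of_real[symmetric])
  \<comment> \<open>The constants match because
    \<open>sqrt (2 * pi) = 2 * pi / sqrt (2 * pi)\<close>.\<close>
  also have "sqrt (2 * pi) / s * exp (- ((1 / s)\<^sup>2 * (m - x)\<^sup>2 / 2)) = 2 * pi * normal_density m s x"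
    using assms by (simp add: normal_density_def real_sqrt_mult power2_commute[of m x]
        real_div_sqrt field_simps flip: power2_eq_square)
  finally show ?thesis by simp
qed

text \<open>A bound uniform in \<open>m\<close> and \<open>x\<close>, used as a constant dominating
  function below.\<close>

lemma normal_density_le:
  "normal_density m s x \<le> 1 / sqrt (2 * pi * s\<^sup>2)"
  unfolding normal_density_def by (simp add: divide_right_mono)

lemma borel_measurable_normal_density_shift [measurable]:
  "(\<lambda>(y, x). normal_density (m + y) s x) \<in> borel_measurable (borel \<Otimes>\<^sub>M borel)"
  unfolding normal_density_def by measurable

text \<open>For \<open>0 < s\<close> and a probability law \<open>L\<close>, this is the density of
  the convolution of \<open>L\<close> with the normal law of mean \<open>m\<close> and standard
  deviation \<open>s\<close>.\<close>

definition gaussian_mixture_density :: "real measure \<Rightarrow> real \<Rightarrow> real \<Rightarrow> real \<Rightarrow> real" where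
  "gaussian_mixture_density L m s x = (\<integral>y. normal_density (m + y) s x \<partial>L)"

context real_distribution
begin

lemma gaussian_mixture_density_nonneg: "0 \<le> gaussian_mixture_density M m s x"
  by (simp add: gaussian_mixture_density_def)

lemma integrable_normal_density_location: "integrable M (\<lambda>y. normal_density (m + y) s x)"
  by (rule integrable_const_bound[where B="1 / sqrt (2 * pi * s\<^sup>2)"])
    (auto simp: normal_density_le)

text \<open>Dominated convergence: the integrands are continuous in \<open>x\<close> and bounded by
  one constant, which is integrable over a probability measure.\<close>

lemma continuous_on_gaussian_mixture_density:
  "continuous_on UNIV (gaussian_mixture_density M m s)"
proof (clarsimp simp: continuous_on_sequentially comp_def)
  fix x :: real and X :: "nat \<Rightarrow> real" assume "X \<longlonglongrightarrow> x"
  then show "(\<lambda>n. gaussian_mixture_density M m s (X n)) \<longlonglongrightarrow> gaussian_mixture_density M m s x"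
    unfolding gaussian_mixture_density_def
  proof (intro integral_dominated_convergence[where w="\<lambda>_. 1 / sqrt (2 * pi * s\<^sup>2)"] AE_I2)
    fix y
    show "(\<lambda>n. normal_density (m + y) s (X n)) \<longlonglongrightarrow> normal_density (m + y) s x"
      unfolding normal_density_def divide_inverse by (intro tendsto_intros \<open>X \<longlonglongrightarrow> x\<close>)
  qed (auto simp: normal_density_le)
qed

lemma borel_measurable_gaussian_mixture_density [measurable]:
  "gaussian_mixture_density M m s \<in> borel_measurable borel"
  using continuous_on_gaussian_mixture_density by (rule borel_measurable_continuous_onI)

lemma integrable_gaussian_char:
  assumes "0 < s"
  shows "integrable lborel (\<lambda>u. iexp (u * c) * of_real (exp (- (s\<^sup>2 * u\<^sup>2 / 2))) * char M u)"
  by (rule Bochner_Integration.integrable_bound[OF integrable_gaussian_exponential[OF assms]])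
    (auto simp: norm_mult cmod_char_le_1 intro!: mult_left_le)

text \<open>Gaussian inversion is integrated over the random location \<open>y\<close>. After
  Fubini, \<open>y\<close> enters only through \<open>iexp (u * y)\<close>, which integrates to
  \<open>char M u\<close>.\<close>

lemma gaussian_mixture_density_inversion:
  assumes s: "0 < s"
  shows "complex_of_real (gaussian_mixture_density M m s x) = 1 / (2 * of_real pi)
    * (CLINT u|lborel. iexp (u * (m - x)) * of_real (exp (- (s\<^sup>2 * u\<^sup>2 / 2))) * char M u)"
proof -
  interpret P: pair_sigma_finite M lborel ..
  let ?h = "\<lambda>y u. iexp (u * (m + y - x)) * of_real (exp (- (s\<^sup>2 * u\<^sup>2 / 2)))"
  \<comment> \<open>The modulus of \<open>?h y u\<close> is a Gaussian in \<open>u\<close> that does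
    not depend on \<open>y\<close>, and \<open>M\<close> has mass one.\<close>
  have int: "integrable (M \<Otimes>\<^sub>M lborel) (\<lambda>(y, u). ?h y u)"
    by (rule P.Fubini_integrable)
      (auto simp: norm_mult integrable_gaussian_exponential[OF s]
        intro!: Bochner_Integration.integrable_bound[OF integrable_gaussian_exponential[OF s]])
  have "complex_of_real (gaussian_mixture_density M m s x)
      = (CLINT y|M. of_real (normal_density (m + y) s x))"
    by (simp add: gaussian_mixture_density_def)
  also have "\<dots> = (CLINT y|M. 1 / (2 * of_real pi) * (CLINT u|lborel. ?h y u))"
    by (simp only: normal_density_Fourier_inversion[OF s])
  also have "\<dots> = 1 / (2 * of_real pi) * (CLINT y|M. CLINT u|lborel. ?h y u)"
    by (rule integral_mult_right_zero)
  also have "(CLINT y|M. CLINT u|lborel. ?h y u) = (CLINT u|lborel. CLINT y|M. ?h y u)"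
    using P.Fubini_integral[OF int] by simp
  also have "\<dots> = (CLINT u|lborel. CLINT y|M.
      (iexp (u * (m - x)) * of_real (exp (- (s\<^sup>2 * u\<^sup>2 / 2)))) * iexp (u * y))"
    by (intro Bochner_Integration.integral_cong refl)
      (simp add: exp_add[symmetric] algebra_simps)
  finally show ?thesis
    by (simp add: char_def)
qed

text \<open>Tonelli gives total mass one and Fubini the characteristic function; together they allow
  the mixture to be identified by Levy uniqueness.\<close>

lemma gaussian_mixture_density_distribution:
  assumes s: "0 < s"
  shows "real_distribution (density lborel (gaussian_mixture_density M m s))" (is ?A)
    and "char (density lborel (gaussian_mixture_density M m s)) v
      = exp (\<i> * of_real (v * m) - of_real (s\<^sup>2 * v\<^sup>2 / 2)) * char M v" (is ?B)
proof -
  interpret P: pair_sigma_finite M lborel ..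
  have one: "(\<integral>\<^sup>+ x. ennreal (normal_density c s x) \<partial>lborel) = 1" for c
    using s by (simp add: nn_integral_eq_integral)
  have "(\<integral>\<^sup>+ x. ennreal (gaussian_mixture_density M m s x) \<partial>lborel)
      = (\<integral>\<^sup>+ x. \<integral>\<^sup>+ y. ennreal (normal_density (m + y) s x) \<partial>M \<partial>lborel)"
    unfolding gaussian_mixture_density_def
    by (intro nn_integral_cong nn_integral_eq_integral[symmetric] integrable_normal_density_location) simp
  also have "\<dots> = (\<integral>\<^sup>+ y. \<integral>\<^sup>+ x. ennreal (normal_density (m + y) s x) \<partial>lborel \<partial>M)"
    by (rule P.Fubini') measurable
  also have "\<dots> = 1"
    by (simp add: one emeasure_space_1 del: space_eq_univ)
  finally show ?A
    by (auto simp: real_distribution_def real_distribution_axioms_def emeasure_density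
        intro!: prob_spaceI)
  let ?g = "\<lambda>y x. normal_density (m + y) s x *\<^sub>R iexp (v * x)"
  have int: "integrable (M \<Otimes>\<^sub>M lborel) (\<lambda>(y, x). ?g y x)"
  proof (rule P.Fubini_integrable)
    show "AE y in M. integrable lborel (\<lambda>x. case (y, x) of (y, x) \<Rightarrow> ?g y x)"
      by (rule AE_I2, rule Bochner_Integration.integrable_bound[OF integrable_normal_density[OF s]]) auto
  qed (use s in auto)
  have "char (density lborel (gaussian_mixture_density M m s)) v
     = (CLINT x|lborel. gaussian_mixture_density M m s x *\<^sub>R iexp (v * x))"
    by (simp add: char_def integral_density gaussian_mixture_density_nonneg)
  also have "\<dots> = (CLINT x|lborel. CLINT y|M. ?g y x)"
    unfolding gaussian_mixture_density_def
    by (intro Bochner_Integration.integral_cong refl integral_scaleR_left[symmetric])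
      (rule integrable_normal_density_location)
  also have "\<dots> = (CLINT y|M. CLINT x|lborel. ?g y x)"
    using P.Fubini_integral[OF int] by simp
  also have "\<dots> = (CLINT y|M. char (density lborel (normal_density (m + y) s)) v)"
    by (simp add: char_def integral_density)
  also have "\<dots> = (CLINT y|M. exp (\<i> * of_real (v * m) - of_real (s\<^sup>2 * v\<^sup>2 / 2)) * iexp (v * y))"
    by (intro Bochner_Integration.integral_cong refl)
      (simp only: char_normal_density[OF s], simp add: exp_add[symmetric] algebra_simps)
  finally show ?B
    by (simp add: char_def)
qed

end

subsection \<open>Poisson random measures of finite intensity\<close>

lemma poisson_weights_sums:
  "(\<lambda>k. exp (- m) * m ^ k / fact k) sums (1::real)"
proof -
  have "(\<lambda>k. exp (- m) * (m ^ k /\<^sub>R fact k)) sums (exp (- m) * exp m)"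
    by (intro sums_mult exp_converges)
  then show ?thesis
    by (simp add: exp_minus divide_inverse mult_ac)
qed

text \<open>Finite intensity makes the Poisson law apply to the count of every measurable set, the
  whole space included.\<close>

locale finite_poisson_random_measure = prob_space Q + intensity: finite_measure \<mu>
  for Q :: "'a measure" and \<mu> :: "'b measure" +
  fixes N :: "'a \<Rightarrow> 'b measure"
  assumes prm: "poisson_random_measure Q \<mu> N"
begin

text \<open>The sigma-algebra of \<open>N\<close>, packaged as a measure so that measurability with
  respect to it can be stated. Such measurability is what carries independence from \<open>W\<close>
  over to the jump part.\<close>

definition generated_algebra :: "'a measure" where
  "generated_algebra = sigma (space Q) (random_measure_sigma Q \<mu> N)"

lemma random_measure_sigma_subset: "random_measure_sigma Q \<mu> N \<subseteq> Pow (space Q)"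
  unfolding random_measure_sigma_def by (rule sigma_sets_into_sp[THEN subsetI[OF PowI]]) auto

lemma sets_generated_algebra: "sets generated_algebra = random_measure_sigma Q \<mu> N"
  unfolding generated_algebra_def
  by (subst sets_measure_of[OF random_measure_sigma_subset])
    (auto simp: random_measure_sigma_def intro!: sigma_sets_sigma_sets_eq)

lemma space_generated_algebra [simp]: "space generated_algebra = space Q"
  by (simp add: generated_algebra_def space_measure_of_conv)

lemma sets_N: "\<omega> \<in> space Q \<Longrightarrow> sets (N \<omega>) = sets \<mu>"
  using prm by (simp add: poisson_random_measure_def)

lemma space_N: "\<omega> \<in> space Q \<Longrightarrow> space (N \<omega>) = space \<mu>"
  using sets_eq_imp_space_eq[OF sets_N] .

lemma measurable_generated_algebra:
  assumes "A \<in> sets \<mu>"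
  shows "(\<lambda>\<omega>. emeasure (N \<omega>) A) \<in> borel_measurable generated_algebra"
  by (rule measurableI)
    (use assms in \<open>auto simp: sets_generated_algebra random_measure_sigma_def\<close>)

lemma subalgebra_generated_algebra: "subalgebra Q generated_algebra"
proof -
  have "(\<lambda>\<omega>. emeasure (N \<omega>) A) -` B \<inter> space Q \<in> sets Q" if "A \<in> sets \<mu>" "B \<in> sets borel" for A B
    using prm that by (auto simp: poisson_random_measure_def intro: measurable_sets)
  then show ?thesis
    unfolding subalgebra_def sets_generated_algebra random_measure_sigma_def
    by (auto intro!: sigma_sets_le_sets_iff[THEN iffD2])
qed

section \<open>The law of a single count\<close>

lemma measurable_count [measurable]:
  assumes "A \<in> sets \<mu>"
  shows "(\<lambda>\<omega>. emeasure (N \<omega>) A) \<in> borel_measurable Q"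
  using measurable_from_subalg[OF subalgebra_generated_algebra measurable_generated_algebra[OF assms]] .

lemma prob_count_eq:
  assumes "A \<in> sets \<mu>"
  shows "prob {\<omega> \<in> space Q. emeasure (N \<omega>) A = of_nat k}
    = exp (- measure \<mu> A) * measure \<mu> A ^ k / fact k"
  using prm assms by (simp add: poisson_random_measure_def less_top[symmetric])

text \<open>A count takes values in the extended nonnegative reals; since the Poisson weights sum to
  one, values outside the naturals have probability zero.\<close>

lemma AE_count_nat:
  assumes A: "A \<in> sets \<mu>"
  shows "AE \<omega> in Q. \<exists>k::nat. emeasure (N \<omega>) A = of_nat k"
proof -
  let ?E = "\<lambda>k::nat. {\<omega> \<in> space Q. emeasure (N \<omega>) A = of_nat k}"
  have [measurable]: "?E k \<in> sets Q" for k
    using A by measurable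
  have "(\<lambda>k. prob (?E k)) sums prob (\<Union>k. ?E k)"
    by (intro finite_measure_UNION) (auto simp: disjoint_family_on_def)
  then have "prob (\<Union>k. ?E k) = 1"
    using poisson_weights_sums[of "measure \<mu> A"]
    by (simp add: prob_count_eq[OF A] sums_unique2)
  then have "AE \<omega> in Q. \<omega> \<in> (\<Union>k. ?E k)"
    by (intro AE_prob_1)
  then show ?thesis by eventually_elim auto
qed

lemma char_count:
  assumes A: "A \<in> sets \<mu>"
  shows "char (distr Q borel (\<lambda>\<omega>. enn2real (emeasure (N \<omega>) A))) v
    = exp (of_real (measure \<mu> A) * (iexp v - 1))"
proof -
  let ?m = "measure \<mu> A"
  let ?p = "\<lambda>k::nat. exp (- ?m) * ?m ^ k / fact k"
  \<comment> \<open>A version of the count with values in the naturals, so that its law is discrete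
    and expectations become series.\<close>
  define K where "K \<omega> = nat \<lfloor>enn2real (emeasure (N \<omega>) A)\<rfloor>" for \<omega>
  have [measurable]: "(\<lambda>\<omega>. emeasure (N \<omega>) A) \<in> borel_measurable Q"
    using A by measurable
  have K [measurable]: "K \<in> measurable Q (count_space UNIV)"
    unfolding K_def by measurable
  have AE_K: "AE \<omega> in Q. emeasure (N \<omega>) A = of_nat (K \<omega>)"
    using AE_count_nat[OF A] by eventually_elim (auto simp: K_def)
  \<comment> \<open>A density over counting measure also covers the rate
    \<open>?m = 0\<close>.\<close>
  have distr_K: "distr Q (count_space UNIV) K = density (count_space UNIV) (\<lambda>k. ennreal (?p k))"
  proof (rule measure_eqI_countable[where A=UNIV])
    fix k :: nat
    have "emeasure (distr Q (count_space UNIV) K) {k} = emeasure Q {\<omega> \<in> space Q. K \<omega> = k}"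
      by (subst emeasure_distr) (auto intro!: arg_cong[where f="emeasure Q"])
    also have "\<dots> = emeasure Q {\<omega> \<in> space Q. emeasure (N \<omega>) A = of_nat k}"
      by (rule emeasure_eq_AE) (use AE_K in \<open>auto elim: AE_mp\<close>)
    also have "\<dots> = ennreal (?p k)"
      by (simp add: emeasure_eq_measure prob_count_eq[OF A])
    finally show "emeasure (distr Q (count_space UNIV) K) {k}
        = emeasure (density (count_space UNIV) (\<lambda>k. ennreal (?p k))) {k}"
      by (simp add: emeasure_density)
  qed auto
  have "summable ?p"
    using poisson_weights_sums by (rule sums_summable)
  then have int: "integrable (count_space UNIV) (\<lambda>k. ?p k *\<^sub>R iexp (v * real k))"
    by (simp add: integrable_count_space_nat_iff)
  have "char (distr Q borel (\<lambda>\<omega>. enn2real (emeasure (N \<omega>) A))) v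
      = (CLINT \<omega>|Q. iexp (v * enn2real (emeasure (N \<omega>) A)))"
    by (simp add: char_def integral_distr)
  also have "\<dots> = (CLINT \<omega>|Q. iexp (v * real (K \<omega>)))"
    by (rule integral_cong_AE) (use AE_K in auto)
  also have "\<dots> = (CLINT k|distr Q (count_space UNIV) K. iexp (v * real k))"
    by (simp add: integral_distr)
  also have "\<dots> = (CLINT k|count_space UNIV. ?p k *\<^sub>R iexp (v * real k))"
    unfolding distr_K by (subst integral_density) auto
  also have "\<dots> = (\<Sum>k. ?p k *\<^sub>R iexp (v * real k))"
    by (rule integral_count_space_nat[OF int])
  \<comment> \<open>Regrouped into the exponential series at
    \<open>of_real ?m * iexp v\<close>.\<close>
  also have "\<dots> = (\<Sum>k. of_real (exp (- ?m)) * ((of_real ?m * iexp v) ^ k /\<^sub>R fact k))"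
    by (intro suminf_cong)
      (simp add: scaleR_conv_of_real power_mult_distrib exp_of_nat_mult[symmetric] divide_inverse mult_ac)
  also have "\<dots> = of_real (exp (- ?m)) * exp (of_real ?m * iexp v)"
    by (intro sums_unique[symmetric] sums_mult exp_converges)
  also have "\<dots> = exp (of_real ?m * (iexp v - 1))"
    by (simp add: exp_of_real[symmetric] exp_add[symmetric] algebra_simps)
  finally show ?thesis .
qed

text \<open>The integral of a simple \<open>f\<close> against \<open>N \<omega>\<close>, written
  through counts of its level sets: measurability in \<open>\<omega>\<close> is then immediate, and
  the summands involve disjoint sets. Infinite counts are sent to \<open>0\<close> by
  \<open>enn2real\<close>, hence the finiteness condition when comparing with the integral.\<close>

definition step_sum :: "('b \<Rightarrow> real) \<Rightarrow> 'a \<Rightarrow> real" where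
  "step_sum f \<omega> = (\<Sum>y\<in>f ` space \<mu>. y * enn2real (emeasure (N \<omega>) (f -` {y} \<inter> space \<mu>)))"

lemma step_sum_measurable:
  assumes "simple_function \<mu> f"
  shows "step_sum f \<in> borel_measurable generated_algebra"
  unfolding step_sum_def using simple_functionD(2)[OF assms]
  by (intro borel_measurable_sum borel_measurable_times borel_measurable_const
      borel_measurable_enn2real measurable_generated_algebra) auto

lemma AE_finite_N: "AE \<omega> in Q. finite_measure (N \<omega>)"
  using AE_count_nat[OF sets.top] AE_space
  by eventually_elim (auto intro!: finite_measureI simp: space_N)

lemma integral_N_simple:
  assumes f: "simple_function \<mu> f" and \<omega>: "\<omega> \<in> space Q" and "finite_measure (N \<omega>)"
  shows "(\<integral>x. f x \<partial>N \<omega>) = step_sum f \<omega>"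
proof -
  interpret N: finite_measure "N \<omega>" by fact
  note [simp] = sets_N[OF \<omega>] space_N[OF \<omega>]
  have [measurable]: "f -` {y} \<inter> space \<mu> \<in> sets \<mu>" for y
    by (rule simple_functionD(2)[OF f])
  have "(\<integral>x. f x \<partial>N \<omega>) = (\<integral>x. (\<Sum>y\<in>f ` space \<mu>. y * indicator (f -` {y} \<inter> space \<mu>) x) \<partial>N \<omega>)"
  proof (rule Bochner_Integration.integral_cong[OF refl])
    fix x assume "x \<in> space (N \<omega>)"
    then have x: "x \<in> space \<mu>" by simp
    have "(\<Sum>y\<in>f ` space \<mu>. y * indicator (f -` {y} \<inter> space \<mu>) x)
        = (\<Sum>y\<in>f ` space \<mu>. if y = f x then y else 0)"
      using x by (intro sum.cong) (auto simp: indicator_def)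
    also have "\<dots> = f x"
      using x simple_functionD(1)[OF f] by simp
    finally show "f x = (\<Sum>y\<in>f ` space \<mu>. y * indicator (f -` {y} \<inter> space \<mu>) x)" ..
  qed
  also have "\<dots> = (\<Sum>y\<in>f ` space \<mu>. \<integral>x. y * indicator (f -` {y} \<inter> space \<mu>) x \<partial>N \<omega>)"
    by (intro Bochner_Integration.integral_sum integrable_mult_right integrable_real_indicator)
      (auto simp: less_top[symmetric])
  also have "\<dots> = step_sum f \<omega>"
    by (simp add: step_sum_def measure_def Int_absorb1)
  finally show ?thesis .
qed

text \<open>Campbell's formula for simple functions: the counts of the level sets are independent
  Poisson variables, so their characteristic functions multiply and the exponents add up to the
  integral.\<close>

lemma char_step_sum:
  assumes f: "simple_function \<mu> f"
  shows "char (distr Q borel (step_sum f)) v = exp (CLINT x|\<mu>. iexp (v * f x) - 1)"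
proof -
  \<comment> \<open>The values of \<open>f\<close> are enumerated because independence of counts is
    stated for families indexed by \<open>{..<n}\<close>.\<close>
  obtain h n where h: "bij_betw h {..<n::nat} (f ` space \<mu>)"
    using ex_bij_betw_nat_finite[OF simple_functionD(1)[OF f]] by (auto simp: lessThan_atLeast0)
  define A where "A i = f -` {h i} \<inter> space \<mu>" for i
  have A [measurable]: "A i \<in> sets \<mu>" for i
    unfolding A_def by (rule simple_functionD(2)[OF f])
  have "disjoint_family_on A {..<n}"
    using bij_betw_imp_inj_on[OF h] by (auto simp: disjoint_family_on_def A_def inj_on_def)
  then have "indep_vars (\<lambda>_. borel) (\<lambda>i \<omega>. emeasure (N \<omega>) (A i)) {..<n}"
    using prm A by (auto simp: poisson_random_measure_def)
  then have indep: "indep_vars (\<lambda>_. borel) (\<lambda>i \<omega>. h i * enn2real (emeasure (N \<omega>) (A i))) {..<n}"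
    by (rule indep_vars_compose2) measurable
  have sum_eq: "step_sum f = (\<lambda>\<omega>. \<Sum>i<n. h i * enn2real (emeasure (N \<omega>) (A i)))"
    unfolding step_sum_def A_def by (intro ext sum.reindex_bij_betw[OF h, symmetric])
  have char_i: "char (distr Q borel (\<lambda>\<omega>. h i * enn2real (emeasure (N \<omega>) (A i)))) v
      = exp (of_real (measure \<mu> (A i)) * (iexp (v * h i) - 1))" for i
    using char_count[OF A, of i "v * h i"] by (simp add: char_def integral_distr mult_ac)
  have "(CLINT x|\<mu>. iexp (v * f x) - 1)
      = (CLINT x|\<mu>. (\<Sum>i<n. indicator (A i) x *\<^sub>R (iexp (v * h i) - 1)))"
  proof (rule Bochner_Integration.integral_cong[OF refl])
    fix x assume x: "x \<in> space \<mu>"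
    then obtain j where j: "j < n" "h j = f x"
      using bij_betw_imp_surj_on[OF h] by (metis imageE image_eqI lessThan_iff)
    have "(\<Sum>i<n. indicator (A i) x *\<^sub>R (iexp (v * h i) - 1))
        = (\<Sum>i<n. if i = j then iexp (v * h i) - 1 else 0)"
      using j x bij_betw_imp_inj_on[OF h]
      by (intro sum.cong) (auto simp: A_def indicator_def inj_on_def)
    then show "iexp (v * f x) - 1 = (\<Sum>i<n. indicator (A i) x *\<^sub>R (iexp (v * h i) - 1))"
      using j by simp
  qed
  also have "\<dots> = (\<Sum>i<n. of_real (measure \<mu> (A i)) * (iexp (v * h i) - 1))"
    by (subst Bochner_Integration.integral_sum)
      (auto simp: less_top[symmetric] scaleR_conv_of_real)
  finally show ?thesis
    unfolding sum_eq char_distr_sum[OF indep] char_i by (simp add: exp_sum)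
qed

text \<open>The sets where \<open>\<bar>g x\<bar>\<close> exceeds \<open>n\<close> decrease to the
  empty set, so their finite intensities tend to zero, and with them the probabilities of a nonzero
  count.\<close>

lemma AE_count_eventually_zero:
  fixes g :: "'b \<Rightarrow> real"
  assumes [measurable]: "g \<in> borel_measurable \<mu>"
  shows "AE \<omega> in Q. \<exists>n::nat. emeasure (N \<omega>) {x \<in> space \<mu>. real n < \<bar>g x\<bar>} = 0"
proof -
  let ?A = "\<lambda>n::nat. {x \<in> space \<mu>. real n < \<bar>g x\<bar>}"
  let ?E = "{\<omega> \<in> space Q. \<forall>n. emeasure (N \<omega>) (?A n) \<noteq> 0}"
  have A [measurable]: "?A n \<in> sets \<mu>" for n by measurable
  have E [measurable]: "?E \<in> sets Q" by measurable
  have "(\<lambda>n. measure \<mu> (?A n)) \<longlonglongrightarrow> measure \<mu> (\<Inter>n. ?A n)"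
    by (intro intensity.finite_Lim_measure_decseq) (auto simp: decseq_def)
  moreover have "\<exists>n. \<not> real n < \<bar>g x\<bar>" for x
    using reals_Archimedean2[of "\<bar>g x\<bar>"] by (metis order.asym)
  then have "(\<Inter>n. ?A n) = {}" by blast
  ultimately have "(\<lambda>n. measure \<mu> (?A n)) \<longlonglongrightarrow> 0" by simp
  then have lim: "(\<lambda>n. 1 - exp (- measure \<mu> (?A n))) \<longlonglongrightarrow> 1 - exp (- 0)"
    by (intro tendsto_intros)
  have "prob ?E \<le> 1 - exp (- measure \<mu> (?A n))" for n
  proof -
    have "prob ?E \<le> prob (space Q - {\<omega> \<in> space Q. emeasure (N \<omega>) (?A n) = of_nat 0})"
      by (intro finite_measure_mono) auto
    also have "\<dots> = 1 - prob {\<omega> \<in> space Q. emeasure (N \<omega>) (?A n) = of_nat 0}"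
      by (rule prob_compl) measurable
    finally show ?thesis
      unfolding prob_count_eq[OF A] by simp
  qed
  then have "prob ?E \<le> 0"
    using LIMSEQ_le_const[OF lim] by auto
  then have "AE \<omega> in Q. \<omega> \<notin> ?E"
    using E by (intro AE_not_in) (auto simp: null_sets_def emeasure_eq_measure measure_le_0_iff)
  with AE_space show ?thesis by eventually_elim auto
qed

text \<open>No integrability of \<open>g\<close> is required: the intensity being finite, \<open>g\<close> is almost surely bounded
  \<open>N \<omega>\<close>-almost everywhere, so the pathwise integral is a limit of step sums.\<close>

proposition poisson_integral_char:
  fixes g :: "'b \<Rightarrow> real"
  assumes g: "g \<in> borel_measurable \<mu>"
  obtains S where "S \<in> borel_measurable generated_algebra"
    and "AE \<omega> in Q. S \<omega> = (\<integral>x. g x \<partial>N \<omega>)"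
    and "\<And>v. char (distr Q borel S) v = exp (CLINT x|\<mu>. iexp (v * g x) - 1)"
proof -
  \<comment> \<open>The factor \<open>2\<close> is that of the library's simple approximation, taken
    relative to the base point \<open>0\<close>.\<close>
  obtain f where f: "\<And>i. simple_function \<mu> (f i)"
    and f_lim: "\<And>x. x \<in> space \<mu> \<Longrightarrow> (\<lambda>i. f i x) \<longlonglongrightarrow> g x"
    and f_bound: "\<And>i x. x \<in> space \<mu> \<Longrightarrow> \<bar>f i x\<bar> \<le> 2 * \<bar>g x\<bar>"
    using borel_measurable_implies_sequence_metric[OF g, of 0] unfolding dist_norm by auto metis
  \<comment> \<open>A limit of step sums is measurable for the algebra of \<open>N\<close> at every
    \<open>\<omega>\<close>, whereas the pathwise integral agrees with it only almost
    surely.\<close>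
  define S where "S \<omega> = lim (\<lambda>i. step_sum (f i) \<omega>)" for \<omega>
  have S: "S \<in> borel_measurable generated_algebra"
    unfolding S_def[abs_def] by (intro borel_measurable_lim_metric step_sum_measurable f)
  note meas_Q = measurable_from_subalg[OF subalgebra_generated_algebra]
  note [measurable] = meas_Q[OF S] meas_Q[OF step_sum_measurable[OF f]]
    g borel_measurable_simple_function[OF f]
  have lim: "AE \<omega> in Q. (\<lambda>i. step_sum (f i) \<omega>) \<longlonglongrightarrow> (\<integral>x. g x \<partial>N \<omega>)"
    using AE_finite_N AE_count_eventually_zero[OF g] AE_space
  proof eventually_elim
    case (elim \<omega>)
    then obtain n :: nat where n: "emeasure (N \<omega>) {x \<in> space \<mu>. real n < \<bar>g x\<bar>} = 0" by auto
    interpret N: finite_measure "N \<omega>" by fact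
    note [measurable_cong] = sets_N[OF elim(3)]
    note sp = space_N[OF elim(3)]
    have "AE x in N \<omega>. \<not> real n < \<bar>g x\<bar>"
      using n by (subst AE_iff_measurable) (auto simp: sp sets_N[OF elim(3)])
    then have bound: "AE x in N \<omega>. norm (f i x) \<le> 2 * real n" for i
      using AE_space
    proof eventually_elim
      case (elim x)
      then show ?case using f_bound[of x i] by (auto simp: sp)
    qed
    have "(\<lambda>i. \<integral>x. f i x \<partial>N \<omega>) \<longlonglongrightarrow> (\<integral>x. g x \<partial>N \<omega>)"
      by (rule integral_dominated_convergence[where w="\<lambda>_. 2 * real n"])
        (use bound in \<open>auto simp: sp f_lim\<close>)
    then show ?case
      by (simp add: integral_N_simple[OF f elim(3,1)])
  qed
  have AE_S: "AE \<omega> in Q. S \<omega> = (\<integral>x. g x \<partial>N \<omega>)"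
    using lim by eventually_elim (auto simp: S_def intro: limI)
  \<comment> \<open>Both sides of the formula for \<open>f i\<close> converge by dominated
    convergence, with dominating constants \<open>1\<close> over \<open>Q\<close> and
    \<open>2\<close> over the finite measure \<open>\<mu>\<close>.\<close>
  have "char (distr Q borel S) v = exp (CLINT x|\<mu>. iexp (v * g x) - 1)" for v
  proof (rule LIMSEQ_unique)
    have "(\<lambda>i. CLINT \<omega>|Q. iexp (v * step_sum (f i) \<omega>)) \<longlonglongrightarrow> (CLINT \<omega>|Q. iexp (v * S \<omega>))"
    proof (rule integral_dominated_convergence[where w="\<lambda>_. 1"])
      show "AE \<omega> in Q. (\<lambda>i. iexp (v * step_sum (f i) \<omega>)) \<longlonglongrightarrow> iexp (v * S \<omega>)"
        using lim AE_S by eventually_elim (auto intro!: tendsto_intros)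
    qed auto
    then show "(\<lambda>i. char (distr Q borel (step_sum (f i))) v) \<longlonglongrightarrow> char (distr Q borel S) v"
      by (simp add: char_def integral_distr)
    have "(\<lambda>i. CLINT x|\<mu>. iexp (v * f i x) - 1) \<longlonglongrightarrow> (CLINT x|\<mu>. iexp (v * g x) - 1)"
    proof (rule integral_dominated_convergence[where w="\<lambda>_. 2"])
      show "AE x in \<mu>. norm (iexp (v * f i x) - 1) \<le> 2" for i
        by (rule AE_I2, rule norm_triangle_le_diff) (simp del: of_real_mult)
    qed (auto intro!: tendsto_intros f_lim)
    then show "(\<lambda>i. char (distr Q borel (step_sum (f i))) v) \<longlonglongrightarrow> exp (CLINT x|\<mu>. iexp (v * g x) - 1)"
      unfolding char_step_sum[OF f] by (rule tendsto_exp)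
  qed
  with S AE_S show thesis by (rule that)
qed

end

subsection \<open>Marginal distributions of the process\<close>

text \<open>By independence the characteristic function of the sum is a product, which is that of
  the mixture; Levy uniqueness concludes.\<close>

lemma (in prob_space) distributed_normal_plus_indep:
  assumes Y: "distributed M lborel Y (normal_density m s)" and s: "0 < s"
    and indep: "indep_var borel Y borel S"
  shows "distributed M lborel (\<lambda>\<omega>. Y \<omega> + S \<omega>)
    (\<lambda>x. ennreal (gaussian_mixture_density (distr M borel S) m s x))"
proof -
  have [measurable]: "random_variable borel Y" "random_variable borel S"
    using indep_var_rv1[OF indep] indep_var_rv2[OF indep] .
  interpret S: real_distribution "distr M borel S"
    by (rule real_distribution_distr) measurable
  \<comment> \<open>As targets of \<open>distr\<close>, \<open>borel\<close> and
    \<open>lborel\<close> give the same law: only their common sigma-algebra enters.\<close>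
  have "distr M borel Y = distr M lborel Y"
    by (rule distr_cong) auto
  then have Y_distr: "distr M borel Y = density lborel (normal_density m s)"
    using Y by (simp add: distributed_distr_eq_density)
  have "distr M borel (\<lambda>\<omega>. Y \<omega> + S \<omega>)
      = density lborel (gaussian_mixture_density (distr M borel S) m s)"
  proof (rule Levy_uniqueness)
    show "real_distribution (distr M borel (\<lambda>\<omega>. Y \<omega> + S \<omega>))"
      by (rule real_distribution_distr) measurable
    show "real_distribution (density lborel (gaussian_mixture_density (distr M borel S) m s))"
      by (rule S.gaussian_mixture_density_distribution[OF s])
    show "char (distr M borel (\<lambda>\<omega>. Y \<omega> + S \<omega>))
        = char (density lborel (gaussian_mixture_density (distr M borel S) m s))"
      by (rule ext)
        (simp only: char_distr_add[OF indep] Y_distr char_normal_density[OF s]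
          S.gaussian_mixture_density_distribution(2)[OF s])
  qed
  moreover have "distr M lborel (\<lambda>\<omega>. Y \<omega> + S \<omega>) = distr M borel (\<lambda>\<omega>. Y \<omega> + S \<omega>)"
    by (rule distr_cong) auto
  ultimately show ?thesis
    by (simp add: distributed_def)
qed

text \<open>Preimages under \<open>f\<close> and \<open>g\<close> differ by a subset of a null set,
  which is measurable by completeness. This yields measurability of \<open>X t\<close>, which is
  specified only almost surely.\<close>

lemma (in complete_measure) measurable_AE_eq:
  assumes f: "f \<in> measurable M N" and eq: "AE x in M. f x = g x"
    and g: "g \<in> space M \<rightarrow> space N"
  shows "g \<in> measurable M N"
proof (rule measurableI)
  fix A assume "A \<in> sets N"
  then have A: "f -` A \<inter> space M \<in> sets M"
    using f by (rule measurable_sets[rotated])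
  have "AE x in M. x \<in> f -` A \<inter> space M \<longleftrightarrow> x \<in> g -` A \<inter> space M"
    using eq by eventually_elim auto
  from this A show "g -` A \<inter> space M \<in> sets M"
    by (rule in_sets_AE) auto
qed (use g in auto)

lemma distributed_cong_AE:
  assumes X: "distributed M N X f" and eq: "AE x in M. X x = Y x" and Y: "Y \<in> measurable M N"
  shows "distributed M N Y f"
proof -
  have "distr M N X = distr M N Y"
    using distributed_measurable[OF X] Y eq by (intro distr_cong_AE) auto
  with X Y show ?thesis
    by (simp add: distributed_def)
qed

text \<open>The law has an atom of mass one at \<open>c\<close>, while a density gives every
  singleton mass zero. This settles time \<open>0\<close>.\<close>

lemma (in prob_space) not_distributed_lborel_AE_const:
  fixes X :: "'a \<Rightarrow> real"
  assumes const: "AE \<omega> in M. X \<omega> = c"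
  shows "\<not> distributed M lborel X f"
proof
  assume X: "distributed M lborel X f"
  note [measurable] = distributed_borel_measurable[OF X]
  have [measurable]: "random_variable borel X"
    using distributed_measurable[OF X] by simp
  have "emeasure (distr M lborel X) {c} = emeasure M {\<omega> \<in> space M. X \<omega> = c}"
    by (subst emeasure_distr) (auto intro!: arg_cong[where f="emeasure M"])
  also have "\<dots> = 1"
    using const by (intro emeasure_eq_1_AE) auto
  also have "emeasure (distr M lborel X) {c} = (\<integral>\<^sup>+x. f x * indicator {c} x \<partial>lborel)"
    unfolding distributed_distr_eq_density[OF X] by (rule emeasure_density) auto
  also have "\<dots> = 0"
    using AE_lborel_singleton[of c]
    by (subst nn_integral_0_iff_AE) (auto elim: AE_mp simp: indicator_def)
  finally show False by simp
qed

text \<open>\<open>W t\<close> agrees almost surely with its increment from time \<open>0\<close>;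
  an affine map then gives the stated normal law.\<close>

lemma distributed_brownian_marginal:
  assumes Q: "prob_space Q" and W: "standard_brownian_motion Q T W"
    and t: "t \<in> {0<..T}" and "0 < \<sigma>"
  shows "distributed Q lborel (\<lambda>\<omega>. m + \<sigma> * W t \<omega>) (normal_density m (\<sigma> * sqrt t))"
proof -
  interpret prob_space Q by fact
  have meas: "W t \<in> borel_measurable Q" and zero: "AE \<omega> in Q. W 0 \<omega> = 0"
    using W t by (simp_all add: standard_brownian_motion_def)
  have inc: "distributed Q lborel (\<lambda>\<omega>. W t \<omega> - W 0 \<omega>) (normal_density 0 (sqrt (t - 0)))"
    using W[unfolded standard_brownian_motion_def, THEN conjunct2, THEN conjunct2, THEN conjunct2,
        THEN conjunct1, rule_format, of 0 t] t by simp
  have "AE \<omega> in Q. W t \<omega> - W 0 \<omega> = W t \<omega>"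
    using zero by eventually_elim simp
  from distributed_cong_AE[OF inc this] meas
  have "distributed Q lborel (W t) (normal_density 0 (sqrt t))"
    by simp
  from normal_density_affine[OF this, of \<sigma> m] t \<open>0 < \<sigma>\<close> show ?thesis
    by simp
qed

section \<open>Integration against the jump intensity\<close>

lemma finite_measure_restrict_lborel_interval:
  "finite_measure (restrict_space lborel {a..b::real})"
  by (rule finite_measureI)
    (simp add: emeasure_restrict_space space_restrict_space emeasure_lborel_Icc_eq)

lemma finite_measure_jump_intensity:
  assumes "finite_measure \<nu>"
  shows "finite_measure (jump_intensity T \<nu>)"
  unfolding jump_intensity_def
  by (intro finite_measure_pair_measure assms finite_measure_restrict_lborel_interval)

text \<open>Fubini: \<open>{0<..t}\<close> lies inside the horizon and contributes its length
  \<open>t\<close>.\<close>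

lemma integral_jump_intensity:
  fixes h :: "real \<Rightarrow> 'b::{banach, second_countable_topology}"
  assumes \<nu>: "finite_measure \<nu>" and h: "integrable \<nu> h" and t: "t \<in> {0..T}"
  shows "(\<integral>p. indicator ({0<..t} \<times> UNIV) p *\<^sub>R h (snd p) \<partial>jump_intensity T \<nu>) = t *\<^sub>R (\<integral>z. h z \<partial>\<nu>)"
proof -
  let ?L = "restrict_space lborel {0..T}"
  interpret \<nu>: finite_measure \<nu> by fact
  interpret L: finite_measure ?L
    by (rule finite_measure_restrict_lborel_interval)
  interpret P: pair_sigma_finite ?L \<nu> ..
  have sub: "{0<..t} \<subseteq> {0..T}"
    using t by auto
  then have A: "{0<..t} \<in> sets ?L" "emeasure ?L {0<..t} = ennreal t"
    using t by (simp_all add: sets_restrict_space_iff emeasure_restrict_space)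
  then have A': "measure ?L {0<..t} = t"
    using t by (simp add: measure_def)
  note [measurable] = A(1) borel_measurable_integrable[OF h]
  have int: "integrable (?L \<Otimes>\<^sub>M \<nu>) (\<lambda>(s, z). indicator {0<..t} s *\<^sub>R h z)"
  proof (rule P.Fubini_integrable)
    have "(\<lambda>s. \<integral>z. norm (case (s, z) of (s, z) \<Rightarrow> indicator {0<..t} s *\<^sub>R h z) \<partial>\<nu>)
        = (\<lambda>s. indicator {0<..t} s * (\<integral>z. norm (h z) \<partial>\<nu>))"
      by auto
    then show "integrable ?L (\<lambda>s. \<integral>z. norm (case (s, z) of (s, z) \<Rightarrow> indicator {0<..t} s *\<^sub>R h z) \<partial>\<nu>)"
      by (auto intro!: integrable_mult_left integrable_real_indicator A simp: A(2))
  qed (use h in auto)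
  have "(\<integral>p. indicator ({0<..t} \<times> UNIV) p *\<^sub>R h (snd p) \<partial>jump_intensity T \<nu>)
      = (\<integral>p. (case p of (s, z) \<Rightarrow> indicator {0<..t} s *\<^sub>R h z) \<partial>(?L \<Otimes>\<^sub>M \<nu>))"
    unfolding jump_intensity_def
    by (intro Bochner_Integration.integral_cong) (auto simp: indicator_def)
  also have "\<dots> = (\<integral>s. (\<integral>z. indicator {0<..t} s *\<^sub>R h z \<partial>\<nu>) \<partial>?L)"
    using P.integral_fst'[OF int] by simp
  also have "\<dots> = (\<integral>s. indicator {0<..t} s *\<^sub>R (\<integral>z. h z \<partial>\<nu>) \<partial>?L)"
    by simp
  also have "\<dots> = t *\<^sub>R (\<integral>z. h z \<partial>\<nu>)"
    using A A' by (subst integral_scaleR_left) (auto intro!: integrable_real_indicator simp: Int_absorb2[OF sub])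
  finally show ?thesis .
qed

text \<open>A density is determined only up to null sets, so the formula is proved everywhere for a
  continuous version and almost everywhere for an arbitrary one. Integrability is asserted as well
  because a divergent Bochner integral would default to \<open>0\<close>.\<close>

theorem proposition2p1:
  fixes Q :: "'a measure" and F :: "real \<Rightarrow> 'a measure" and T :: real
    and W :: "real \<Rightarrow> 'a \<Rightarrow> real" and N :: "'a \<Rightarrow> (real \<times> real) measure"
    and \<nu> :: "real measure" and \<sigma> \<eta> \<gamma> :: real
    and X :: "real \<Rightarrow> 'a \<Rightarrow> real"
  assumes "usual_filtered_prob_space Q F T"
    and "standard_brownian_motion Q T W"
    and "levy_measure \<nu>" and "finite_measure \<nu>"
    and "poisson_random_measure Q (jump_intensity T \<nu>) N"
    and "prob_space.indep_set Q (process_sigma Q T W)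
           (random_measure_sigma Q (jump_intensity T \<nu>) N)"
    and "\<sigma> > 0" and "\<gamma> = \<eta> - \<sigma>\<^sup>2 / 2"
    and "\<And>t. t \<in> {0..T} \<Longrightarrow>
           AE \<omega> in Q. X t \<omega> = \<gamma> * t + \<sigma> * W t \<omega> + (LINT p:{0<..t} \<times> UNIV|N \<omega>. snd p)"
  shows "(\<forall>t\<in>{0<..T}. \<exists>f. real_pdf Q (X t) f \<and> continuous_on UNIV f \<and>
            (\<forall>x. integrable lborel (inversion_integrand \<gamma> \<sigma> \<nu> t x) \<and>
                 complex_of_real (f x) =
                   1 / (2 * of_real pi) * (\<integral>u. inversion_integrand \<gamma> \<sigma> \<nu> t x u \<partial>lborel)))
       \<and> (\<forall>t\<in>{0..T}. \<forall>f. real_pdf Q (X t) f \<longrightarrow>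
            (AE x in lborel. complex_of_real (f x) =
               1 / (2 * of_real pi) * (\<integral>u. inversion_integrand \<gamma> \<sigma> \<nu> t x u \<partial>lborel)))"
proof -
  interpret usual_filtered_prob_space Q F T by fact
  have sub_F0: "sets (F 0) \<subseteq> sets Q"
    using subalgebra_F[of 0] horizon_pos by (auto simp: subalgebra_def)
  \<comment> \<open>Subsets of null sets lie in \<open>F 0\<close> by the usual hypotheses, and
    \<open>F 0\<close> is contained in \<open>Q\<close>.\<close>
  interpret complete_measure Q
    by unfold_locales (use complete_F sub_F0 in blast)
  interpret \<nu>: finite_measure \<nu> by fact
  have sets_\<nu> [measurable_cong]: "sets \<nu> = sets borel"
    using assms(3) by (simp add: levy_measure_def)
  let ?\<mu> = "jump_intensity T \<nu>"
  interpret N: finite_poisson_random_measure Q ?\<mu> N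
    using finite_measure_jump_intensity[OF assms(4)] assms(5) prob_space_axioms
    by (simp add: finite_poisson_random_measure_def finite_poisson_random_measure_axioms_def)

  \<comment> \<open>Positive times: a continuous density satisfying the formula\<close>
  have pdf: "\<exists>f. real_pdf Q (X t) f \<and> continuous_on UNIV f \<and>
      (\<forall>x. integrable lborel (inversion_integrand \<gamma> \<sigma> \<nu> t x) \<and>
        complex_of_real (f x) = 1 / (2 * of_real pi) * (\<integral>u. inversion_integrand \<gamma> \<sigma> \<nu> t x u \<partial>lborel))"
    if t: "t \<in> {0<..T}" for t
  proof -
    let ?A = "{0<..t} \<times> (UNIV :: real set)"
    let ?s = "\<sigma> * sqrt t"
    have s: "0 < ?s" and s2: "?s\<^sup>2 = \<sigma>\<^sup>2 * t"
      using t \<open>\<sigma> > 0\<close> by (auto simp: power_mult_distrib)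
    have A [measurable]: "?A \<in> sets ?\<mu>"
      unfolding jump_intensity_def
      using t sets_\<nu> by (intro pair_measureI) (auto simp: sets_restrict_space_iff)
    have snd_meas [measurable]: "snd \<in> borel_measurable ?\<mu>"
      unfolding jump_intensity_def by measurable
    have g: "(\<lambda>p. indicator ?A p * snd p) \<in> borel_measurable ?\<mu>"
      by measurable
    \<comment> \<open>\<open>S\<close> is a version of the jump part up to time \<open>t\<close>,
      measurable with respect to \<open>N\<close> alone.\<close>
    obtain S where S: "S \<in> borel_measurable N.generated_algebra"
      and S_eq: "AE \<omega> in Q. S \<omega> = (\<integral>p. indicator ?A p * snd p \<partial>N \<omega>)"
      and char_S: "\<And>v. char (distr Q borel S) v
          = exp (CLINT p|?\<mu>. iexp (v * (indicator ?A p * snd p)) - 1)"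
      by (rule N.poisson_integral_char[OF g]) (rule that)
    have [measurable]: "S \<in> borel_measurable Q"
      using measurable_from_subalg[OF N.subalgebra_generated_algebra S] .
    interpret S: real_distribution "distr Q borel S"
      by (rule real_distribution_distr) measurable
    have char_S: "char (distr Q borel S) v = exp (of_real t * (\<integral>z. (exp (\<i> * of_real v * of_real z) - 1) \<partial>\<nu>))" for v
    proof -
      have "integrable \<nu> (\<lambda>z. iexp (v * z) - 1)"
        by (rule \<nu>.integrable_const_bound[where B=2], rule AE_I2, rule norm_triangle_le_diff)
          (simp_all del: of_real_mult)
      \<comment> \<open>Off \<open>?A\<close> the left side is \<open>iexp 0 - 1 = 0\<close>, so the
        indicator moves out of the exponential.\<close>
      moreover have "iexp (v * (indicator ?A p * snd p)) - 1
          = indicator ?A p *\<^sub>R (iexp (v * snd p) - 1)" for p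
        by (simp add: indicator_def)
      ultimately show ?thesis
        unfolding char_S
        using integral_jump_intensity[OF assms(4), of "\<lambda>z. iexp (v * z) - 1" t T] t
        by (simp add: scaleR_conv_of_real mult.assoc)
    qed
    have W_meas [measurable]: "W t \<in> borel_measurable Q"
      using assms(2) t by (simp add: standard_brownian_motion_def)
    \<comment> \<open>Independence passes to the smaller sigma-algebras generated by
      \<open>W t\<close> and by \<open>S\<close>.\<close>
    have indep_WS: "indep_var borel (W t) borel S"
      unfolding indep_var_eq
    proof (intro conjI)
      have "sigma_sets (space Q) {W t -` B \<inter> space Q | B. B \<in> sets borel} \<subseteq> process_sigma Q T W"
        unfolding process_sigma_def using t by (intro sigma_sets_mono') force
      moreover have "sigma_sets (space Q) {S -` B \<inter> space Q | B. B \<in> sets borel}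
          \<subseteq> random_measure_sigma Q ?\<mu> N"
        using measurable_sets[OF S]
        unfolding N.sets_generated_algebra[symmetric] N.space_generated_algebra[symmetric]
        by (intro sets.sigma_sets_subset) auto
      ultimately show "indep_set (sigma_sets (space Q) {W t -` B \<inter> space Q | B. B \<in> sets borel})
          (sigma_sets (space Q) {S -` B \<inter> space Q | B. B \<in> sets borel})"
        using assms(6) unfolding indep_sets2_eq by blast
    qed measurable
    have "indep_var borel (\<lambda>\<omega>. \<gamma> * t + \<sigma> * W t \<omega>) borel S"
      by (rule indep_var_compose[OF indep_WS, of "\<lambda>w. \<gamma> * t + \<sigma> * w" borel "\<lambda>x. x" borel,
            unfolded comp_def]) measurable
    from distributed_normal_plus_indep[OF
        distributed_brownian_marginal[OF prob_space_axioms assms(2) t \<open>\<sigma> > 0\<close>] s this]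
    have Y: "distributed Q lborel (\<lambda>\<omega>. \<gamma> * t + \<sigma> * W t \<omega> + S \<omega>)
        (\<lambda>x. ennreal (gaussian_mixture_density (distr Q borel S) (\<gamma> * t) ?s x))" .
    have "AE \<omega> in Q. \<gamma> * t + \<sigma> * W t \<omega> + S \<omega> = X t \<omega>"
    proof -
      have "AE \<omega> in Q. X t \<omega> = \<gamma> * t + \<sigma> * W t \<omega> + (LINT p:?A|N \<omega>. snd p)"
        using t by (intro assms(9)) simp
      then show ?thesis
        using S_eq by eventually_elim (simp add: set_lebesgue_integral_def)
    qed
    moreover from this have "X t \<in> measurable Q lborel"
      by (rule measurable_AE_eq[rotated]) auto
    ultimately have "distributed Q lborel (X t)
        (\<lambda>x. ennreal (gaussian_mixture_density (distr Q borel S) (\<gamma> * t) ?s x))"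
      by (rule distributed_cong_AE[OF Y])
    then have pdf: "real_pdf Q (X t) (gaussian_mixture_density (distr Q borel S) (\<gamma> * t) ?s)"
      by (simp add: real_pdf_def S.gaussian_mixture_density_nonneg)
    \<comment> \<open>The exponential splits into a location factor, a Gaussian factor with variance
      \<open>\<sigma>\<^sup>2 * t\<close>, and the characteristic function of the jump part.\<close>
    have integrand: "inversion_integrand \<gamma> \<sigma> \<nu> t x
        = (\<lambda>u. iexp (u * (\<gamma> * t - x)) * of_real (exp (- (?s\<^sup>2 * u\<^sup>2 / 2))) * char (distr Q borel S) u)" for x
      unfolding inversion_integrand_def char_S s2
      by (rule ext) (simp add: exp_add[symmetric] algebra_simps flip: exp_of_real)
    show ?thesis
      unfolding integrand
      using pdf S.continuous_on_gaussian_mixture_density S.integrable_gaussian_char[OF s]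
        S.gaussian_mixture_density_inversion[OF s]
      by blast
  qed

  \<comment> \<open>Arbitrary densities, including time zero\<close>
  have "AE x in lborel. complex_of_real (f x) =
      1 / (2 * of_real pi) * (\<integral>u. inversion_integrand \<gamma> \<sigma> \<nu> t x u \<partial>lborel)"
    if t: "t \<in> {0..T}" and f: "real_pdf Q (X t) f" for t f
  proof (cases "t = 0")
    case True
    have "AE \<omega> in Q. W 0 \<omega> = 0"
      using assms(2) by (simp add: standard_brownian_motion_def)
    \<comment> \<open>The interval \<open>{0<..0}\<close> is empty, so the jump integral vanishes;
      the resulting point mass contradicts \<open>f\<close>.\<close>
    moreover have "AE \<omega> in Q. X 0 \<omega> = \<sigma> * W 0 \<omega>"
      using assms(9)[of 0] horizon_pos by (simp add: set_lebesgue_integral_def)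
    ultimately have "AE \<omega> in Q. X 0 \<omega> = 0"
      by eventually_elim simp
    from not_distributed_lborel_AE_const[OF this] f True show ?thesis
      by (simp add: real_pdf_def)
  next
    case False
    with t have "t \<in> {0<..T}" by simp
    from pdf[OF this] obtain g where g: "real_pdf Q (X t) g"
      and g_eq: "\<And>x. complex_of_real (g x) =
        1 / (2 * of_real pi) * (\<integral>u. inversion_integrand \<gamma> \<sigma> \<nu> t x u \<partial>lborel)"
      by blast
    have "AE x in lborel. ennreal (f x) = ennreal (g x)"
      using f g unfolding real_pdf_def by (intro distributed_unique[of lborel "X t"]) simp_all
    then show ?thesis
    proof eventually_elim
      case (elim x)
      \<comment> \<open>Both densities are nonnegative, so \<open>ennreal\<close> is injective on
        their values.\<close>
      then have "f x = g x"
        using f g by (simp add: real_pdf_def)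
      then show ?case by (simp only: g_eq)
    qed
  qed
  with pdf show ?thesis by blast
qed

end
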